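(* Let $S, S^*\subseteq F$ be two sets of medians with $|S|=|S^*|=k$. Let $p,\rho\ge 0$ and let $\ell\ge 1$ be an integer. If there is no $\rho$-efficient $\ell$-swap on $S$ with respect to the penalty cost $p$, then $$\mathsf{cost}_p(S)\le \sum_{j\in C}\min\Big\{\Big(3+\frac{2}{\ell}\Big)d_p(j,S^* ),\ \Big(1+\frac1\ell\Big)p\Big\}+k\rho.$$
   Context: $F$ is a set of potential medians, $C$ a finite set of points, $d$ a metric on $F\cup C$. For $p\ge 0$ define $d_p(u,v)=\min\{d(u,v),p\}$ for $u,v\in F\cup C$, $d_p(j,S)=\min_{i\in S}d_p(j,i)$, and $\mathsf{cost}_p(S)=\sum_{j\in C}d_p(j,S)$. For $S\subseteq F$ with $|S|=k$, an $\ell$-swap on $S$ is a pair $(A^*,A)$ with $A\subseteq S$, $A^*\subseteq F\setminus S$, $|A|=|A^*|\le \ell$; applying it replaces $S$ by $S\cup A^*\setminus A$. A swap $(A^*,A)$ on $S$ is $\rho$-efficient with respect to the penalty cost $p$ if $\mathsf{cost}_p(S\cup A^*\setminus A)<\mathsf{cost}_p(S)-|A|\rho$. *)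

theory Defs
  imports "HOL-Analysis.Analysis"
begin

definition trunc_dist :: "('a \<Rightarrow> 'a \<Rightarrow> real) \<Rightarrow> real \<Rightarrow> 'a \<Rightarrow> 'a \<Rightarrow> real" where
  "trunc_dist d p u v = min (d u v) p"

(* Meaningful only for finite nonempty S, since Min is unspecified otherwise. *)
definition trunc_dist_set :: "('a \<Rightarrow> 'a \<Rightarrow> real) \<Rightarrow> real \<Rightarrow> 'a \<Rightarrow> 'a set \<Rightarrow> real" where
  "trunc_dist_set d p j S = Min ((\<lambda>i. trunc_dist d p j i) ` S)"

definition pcost :: "('a \<Rightarrow> 'a \<Rightarrow> real) \<Rightarrow> 'a set \<Rightarrow> real \<Rightarrow> 'a set \<Rightarrow> real" where
  "pcost d C p S = (\<Sum>j\<in>C. trunc_dist_set d p j S)"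

(* Finiteness of Astar is explicit: F may be infinite, and card is 0 on infinite sets. *)
definition is_swap :: "'a set \<Rightarrow> nat \<Rightarrow> 'a set \<Rightarrow> 'a set \<Rightarrow> 'a set \<Rightarrow> bool" where
  "is_swap F l S Astar A \<longleftrightarrow>
     A \<subseteq> S \<and> Astar \<subseteq> F - S \<and> finite A \<and> finite Astar \<and> card A = card Astar \<and> card A \<le> l"

definition apply_swap :: "'a set \<Rightarrow> 'a set \<Rightarrow> 'a set \<Rightarrow> 'a set" where
  "apply_swap S Astar A = (S \<union> Astar) - A"

definition efficient_swap ::
  "('a \<Rightarrow> 'a \<Rightarrow> real) \<Rightarrow> 'a set \<Rightarrow> real \<Rightarrow> real \<Rightarrow> 'a set \<Rightarrow> 'a set \<Rightarrow> 'a set \<Rightarrow> bool" where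
  "efficient_swap d C p \<rho> S Astar A \<longleftrightarrow>
     pcost d C p (apply_swap S Astar A) < pcost d C p S - real (card A) * \<rho>"

end

theory Submission
  imports Defs
begin

text \<open>
  Map every optimal median \<open>x\<close> to a nearest median \<open>\<eta> x\<close> of \<open>S\<close>, and split \<open>S\<close> and \<open>Sstar\<close> into
  groups of equal size, each consisting of a fibre of \<open>\<eta>\<close> on the one side and its image point
  together with points outside the range of \<open>\<eta>\<close> on the other.  Groups of size at most \<open>l\<close> are
  swapped at once; in a group of size \<open>s > l\<close> all single swaps avoiding the image point are
  averaged, which uses each closed median with weight at most \<open>s / (s - 1) \<le> 1 + 1 / l\<close>.
  A client \<open>j\<close> with nearest medians \<open>x\<close> in \<open>Sstar\<close> and \<open>y\<close> in \<open>S\<close> moves to \<open>x\<close> when \<open>x\<close> opens, and to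
  \<open>\<eta> x\<close> when only \<open>y\<close> closes; for the bound in terms of \<open>p\<close> it stays at \<open>y\<close> unless \<open>y\<close>
  closes, and then pays at most \<open>p\<close>.
\<close>

section \<open>Averaging over groups of swaps\<close>

text \<open>The functions \<open>\<alpha>\<close> and \<open>\<beta>\<close> collect the cost changes charged to opened and closed medians.\<close>

lemma swap_averaging_group:
  fixes \<alpha> \<beta> :: "'a \<Rightarrow> real"
  assumes fin: "finite A" "finite B" and card: "card A = card B" and b: "b \<in> A"
    and l: "l \<ge> (1::nat)"
    and \<beta>: "\<And>y. y \<in> A \<Longrightarrow> 0 \<le> \<beta> y"
    and small: "card A \<le> l \<Longrightarrow> 0 \<le> sum \<alpha> B + sum \<beta> A"
    and single: "\<And>x y. x \<in> B \<Longrightarrow> y \<in> A - {b} \<Longrightarrow> 0 \<le> \<alpha> x + \<beta> y"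
  shows "0 \<le> sum \<alpha> B + (1 + 1 / real l) * sum \<beta> A"
proof (cases "card A \<le> l")
  case True
  have "sum \<beta> A \<ge> 0" using \<beta> by (simp add: sum_nonneg)
  then have "sum \<beta> A \<le> (1 + 1 / real l) * sum \<beta> A"
    by (simp add: algebra_simps)
  with small[OF True] show ?thesis by linarith
next
  case False
  define s where "s = real (card A) - 1"
  have s: "s \<ge> real l" "s > 0" using False l by (auto simp: s_def)
  have cA: "real (card (A - {b})) = s"
    using b fin l False by (simp add: s_def card_Diff_singleton of_nat_diff)
  \<comment> \<open>Over all pairs, each \<open>x\<close> occurs \<open>s\<close> times and each
    \<open>y\<close> occurs \<open>card B = s + 1\<close> times; dividing by \<open>s\<close> leaves
    weight \<open>1 + 1 / s\<close> on the closed medians.\<close>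
  have "0 \<le> (\<Sum>x\<in>B. \<Sum>y\<in>A - {b}. \<alpha> x + \<beta> y)"
    by (intro sum_nonneg single)
  also have "\<dots> = s * sum \<alpha> B + (s + 1) * sum \<beta> (A - {b})"
    using card cA by (simp add: sum.distrib sum_distrib_left s_def)
  finally have "0 \<le> s * sum \<alpha> B + (s + 1) * sum \<beta> (A - {b})" .
  then have "0 \<le> (s * sum \<alpha> B + (s + 1) * sum \<beta> (A - {b})) / s"
    using s by simp
  also have "\<dots> = sum \<alpha> B + (1 + 1 / s) * sum \<beta> (A - {b})"
    using s by (simp add: field_simps)
  also have "(1 + 1 / s) * sum \<beta> (A - {b}) \<le> (1 + 1 / real l) * sum \<beta> A"
  proof (rule mult_mono)
    show "1 + 1 / s \<le> 1 + 1 / real l" using s l by (simp add: frac_le)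
    show "sum \<beta> (A - {b}) \<le> sum \<beta> A" using fin \<beta> by (intro sum_mono2) auto
  qed (use \<beta> in \<open>auto intro: sum_nonneg\<close>)
  finally show ?thesis by simp
qed

text \<open>Induction on \<open>card T\<close>, splitting off one group at a time. The disjunction
  on \<open>A\<close> and \<open>B\<close> is what later allows medians common to both sets.\<close>

lemma swap_averaging:
  fixes \<alpha> \<beta> :: "'a \<Rightarrow> real"
  assumes "finite S" "finite T" "card S = card T" "\<eta> ` T \<subseteq> S" and l: "l \<ge> (1::nat)"
    and "\<And>y. y \<in> S \<Longrightarrow> 0 \<le> \<beta> y"
    and "\<And>A B. \<lbrakk>A \<subseteq> S; B \<subseteq> T; card A = card B; card A \<le> l; {x \<in> T. \<eta> x \<in> A} \<subseteq> B;
           \<eta> ` B \<subseteq> A \<or> card A = 1\<rbrakk> \<Longrightarrow> 0 \<le> sum \<alpha> B + sum \<beta> A"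
  shows "0 \<le> sum \<alpha> T + (1 + 1 / real l) * sum \<beta> S"
  using assms(1-4,6,7)
proof (induction "card T" arbitrary: S T rule: less_induct)
  case less
  note finS = less.prems(1) and finT = less.prems(2) and cardST = less.prems(3)
    and \<eta>S = less.prems(4) and \<beta> = less.prems(5) and swap = less.prems(6)
  show ?case
  proof (cases "T = {}")
    case True
    then show ?thesis using cardST finS by simp
  next
    case False
    then obtain x0 where x0: "x0 \<in> T" by auto
    define b where "b = \<eta> x0"
    define B where "B = {x \<in> T. \<eta> x = b}"
    define T' where "T' = T - B"
    have B: "B \<subseteq> T" "finite B" "x0 \<in> B" using finT x0 by (auto simp: B_def b_def)
    have bS: "b \<in> S" using \<eta>S x0 by (auto simp: b_def)
    have cB: "card B \<ge> 1" using B by (metis One_nat_def Suc_leI card_gt_0_iff empty_iff)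
    have cT': "card T' = card T - card B" "card B \<le> card T"
      using B finT by (auto simp: T'_def card_Diff_subset card_mono)
    \<comment> \<open>Removing the fibre \<open>B\<close> costs the range of \<open>\<eta>\<close>
      only the point \<open>b\<close>, so the range has at most \<open>card T' + 1\<close> points.
      As \<open>card S = card T' + card B\<close>, at least \<open>card B - 1\<close> points of
      \<open>S\<close> lie outside it.\<close>
    have im: "\<eta> ` T = insert b (\<eta> ` T')"
      using B x0 by (auto simp: T'_def B_def b_def)
    have "finite T'" using finT by (simp add: T'_def)
    then have "card (\<eta> ` T) \<le> Suc (card T')"
      unfolding im using card_image_le[of T' \<eta>] by (simp add: card_insert_if)
    moreover have "card (S - \<eta> ` T) = card S - card (\<eta> ` T)"
      using \<eta>S finT by (simp add: card_Diff_subset)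
    ultimately have "card B - 1 \<le> card (S - \<eta> ` T)" using cT' cardST cB by linarith
    then obtain D where D: "D \<subseteq> S - \<eta> ` T" "card D = card B - 1" "finite D"
      by (rule obtain_subset_with_card_n)
    define A where "A = insert b D"
    have bD: "b \<notin> D" using D im by auto
    have A: "A \<subseteq> S" "finite A" "b \<in> A" "card A = card B" "A \<inter> \<eta> ` T = {b}"
      using D bD bS cB im by (auto simp: A_def)
    have fibre: "{x \<in> T. \<eta> x \<in> A} = B" using A(5) by (auto simp: B_def)
    have group: "0 \<le> sum \<alpha> B + (1 + 1 / real l) * sum \<beta> A"
    proof (rule swap_averaging_group[OF A(2) B(2) A(4) A(3) l])
      show "0 \<le> \<beta> y" if "y \<in> A" for y using \<beta> A that by auto
      show "0 \<le> sum \<alpha> B + sum \<beta> A" if "card A \<le> l"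
        using swap[OF A(1) B(1) A(4) that] fibre A(3) by (auto simp: B_def)
      show "0 \<le> \<alpha> x + \<beta> y" if "x \<in> B" "y \<in> A - {b}" for x y
      proof -
        \<comment> \<open>The fibre over \<open>y\<close> is empty, so the fibre condition of
          \<open>swap\<close> holds for any single \<open>x\<close>.\<close>
        have "y \<notin> \<eta> ` T" using that A(5) by auto
        then show ?thesis using swap[of "{y}" "{x}"] that A(1) B(1) l by force
      qed
    qed
    have "0 \<le> sum \<alpha> T' + (1 + 1 / real l) * sum \<beta> (S - A)"
    proof (rule less.hyps)
      show "card T' < card T" using cT' cB by linarith
      show "finite (S - A)" "finite T'" using finS finT by (auto simp: T'_def)
      show "card (S - A) = card T'"
        using A finS cT' cardST by (simp add: card_Diff_subset)
      \<comment> \<open>\<open>B\<close> is the whole fibre over \<open>A\<close>, so the remaining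
        points map outside \<open>A\<close>, and fibres over subsets of \<open>S - A\<close> are the
        same in \<open>T'\<close> as in \<open>T\<close>.\<close>
      show "\<eta> ` T' \<subseteq> S - A" using \<eta>S fibre by (auto simp: T'_def)
      show "0 \<le> \<beta> y" if "y \<in> S - A" for y using that \<beta> by auto
      show "0 \<le> sum \<alpha> B' + sum \<beta> A'"
        if "A' \<subseteq> S - A" "B' \<subseteq> T'" "card A' = card B'" "card A' \<le> l"
          "{x \<in> T'. \<eta> x \<in> A'} \<subseteq> B'" "\<eta> ` B' \<subseteq> A' \<or> card A' = 1" for A' B'
      proof (rule swap)
        show "{x \<in> T. \<eta> x \<in> A'} \<subseteq> B'"
          using that(1,5) fibre by (auto simp: T'_def)
      qed (use that in \<open>auto simp: T'_def\<close>)
    qed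
    moreover have "sum \<alpha> T = sum \<alpha> T' + sum \<alpha> B"
      unfolding T'_def using finT B by (metis sum.subset_diff)
    moreover have "sum \<beta> S = sum \<beta> (S - A) + sum \<beta> A"
      using finS A by (metis sum.subset_diff)
    ultimately show ?thesis using group by (simp add: algebra_simps)
  qed
qed

section \<open>Truncated distances and the cost of an exchange\<close>

lemma trunc_dist_set_le:
  assumes "finite S" "i \<in> S"
  shows "trunc_dist_set d p j S \<le> trunc_dist d p j i"
  using assms by (simp add: trunc_dist_set_def)

lemma trunc_dist_set_attained:
  assumes "finite S" "S \<noteq> {}"
  shows "\<exists>i\<in>S. trunc_dist_set d p j S = trunc_dist d p j i"
proof -
  have "trunc_dist_set d p j S \<in> (\<lambda>i. trunc_dist d p j i) ` S"
    unfolding trunc_dist_set_def using assms by (intro Min_in) auto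
  then show ?thesis by auto
qed

lemma pcost_antimono:
  assumes "finite S" "T \<subseteq> S" "T \<noteq> {}"
  shows "pcost d C p S \<le> pcost d C p T"
  unfolding pcost_def trunc_dist_set_def
  using assms by (intro sum_mono Min_antimono) auto

text \<open>
  Swaps may only open medians outside \<open>S\<close>.  If \<open>B\<close> meets \<open>S\<close>, either the common medians are
  also closed and cancel, or the single swap merely deletes a median, which cannot lower the cost.
\<close>

lemma pcost_exchange_ge:
  assumes "finite S" "A \<subseteq> S" "finite B" "B \<subseteq> F" "card A = card B" "card A \<le> l" "\<rho> \<ge> 0"
    and overlap: "B \<inter> S \<subseteq> A \<or> card A = 1"
    and no: "\<not> (\<exists>Astar A. is_swap F l S Astar A \<and> efficient_swap d C p \<rho> S Astar A)"
  shows "pcost d C p S - real (card A) * \<rho> \<le> pcost d C p ((S - A) \<union> B)"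
proof (cases "B \<inter> S \<subseteq> A")
  case True
  have fA: "finite A" using assms finite_subset by auto
  have eq: "apply_swap S (B - S) (A - B) = (S - A) \<union> B"
    using assms(2) by (auto simp: apply_swap_def)
  have "card (A - B) = card A - card (A \<inter> B)" "card (B - S) = card B - card (B \<inter> S)"
    using fA assms(3) by (auto simp: card_Diff_subset_Int)
  moreover have "B \<inter> S = A \<inter> B" using True assms(2) by auto
  ultimately have "card (A - B) = card (B - S)" "card (A - B) \<le> card A"
    using assms(5) by auto
  then have "is_swap F l S (B - S) (A - B)"
    using assms fA by (auto simp: is_swap_def)
  with no have "\<not> efficient_swap d C p \<rho> S (B - S) (A - B)" by blast
  then have "pcost d C p S - real (card (A - B)) * \<rho> \<le> pcost d C p ((S - A) \<union> B)"
    by (simp add: efficient_swap_def eq)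
  moreover have "real (card (A - B)) * \<rho> \<le> real (card A) * \<rho>"
    using \<open>card (A - B) \<le> card A\<close> \<open>\<rho> \<ge> 0\<close> by (intro mult_right_mono) auto
  ultimately show ?thesis by linarith
next
  case False
  then have "card B = 1" using overlap assms(5) by auto
  then obtain x where "B = {x}" by (auto simp: card_1_singleton_iff)
  then have "pcost d C p S \<le> pcost d C p ((S - A) \<union> B)"
    using False assms(1) by (intro pcost_antimono) auto
  then show ?thesis using \<open>\<rho> \<ge> 0\<close> by (smt (verit) mult_nonneg_nonneg of_nat_0_le_iff)
qed

section \<open>Charging clients to medians, and the final bound\<close>

lemma sum_fibres:
  assumes "finite C" "finite B"
  shows "(\<Sum>x\<in>B. \<Sum>j\<in>{j \<in> C. f j = x}. a j) = (\<Sum>j\<in>C. if f j \<in> B then a j else (0::real))"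
proof -
  have "(\<Sum>x\<in>B. \<Sum>j\<in>{j \<in> C. f j = x}. a j) = (\<Sum>x\<in>B. \<Sum>j\<in>C. if f j = x then a j else 0)"
    using assms by (simp add: sum.inter_filter)
  also have "\<dots> = (\<Sum>j\<in>C. \<Sum>x\<in>B. if f j = x then a j else 0)"
    by (rule sum.swap)
  also have "\<dots> = (\<Sum>j\<in>C. if f j \<in> B then a j else 0)"
    using assms by simp
  finally show ?thesis .
qed

theorem theorem3:
  fixes F C S Sstar :: "'a set"
    and d :: "'a \<Rightarrow> 'a \<Rightarrow> real"
    and p \<rho> :: real
    and k l :: nat
  assumes "Metric_space (F \<union> C) d"
    and "finite C"
    and "S \<subseteq> F" and "Sstar \<subseteq> F"
    and "card S = k" and "card Sstar = k" and "k \<ge> 1"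
    and "p \<ge> 0" and "\<rho> \<ge> 0" and "l \<ge> 1"
    and "\<not> (\<exists>Astar A. is_swap F l S Astar A \<and> efficient_swap d C p \<rho> S Astar A)"
  shows "pcost d C p S \<le>
     (\<Sum>j\<in>C. min ((3 + 2 / real l) * trunc_dist_set d p j Sstar) ((1 + 1 / real l) * p))
       + real k * \<rho>"
proof -
  interpret Metric_space "F \<union> C" d by fact
  have fin: "finite S" "S \<noteq> {}" "finite Sstar" "Sstar \<noteq> {}"
    using assms(5-7) by (auto intro: card_ge_0_finite)
  define V where "V j = trunc_dist_set d p j S" for j
  define O' where "O' j = trunc_dist_set d p j Sstar" for j
  have "\<forall>j. \<exists>i. i \<in> S \<and> V j = trunc_dist d p j i"
    unfolding V_def using trunc_dist_set_attained[OF fin(1,2)] by blast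
  then obtain \<sigma> where \<sigma>: "\<And>j. \<sigma> j \<in> S" "\<And>j. V j = trunc_dist d p j (\<sigma> j)"
    by metis
  have "\<forall>j. \<exists>i. i \<in> Sstar \<and> O' j = trunc_dist d p j i"
    unfolding O'_def using trunc_dist_set_attained[OF fin(3,4)] by blast
  then obtain \<omega> where \<omega>: "\<And>j. \<omega> j \<in> Sstar" "\<And>j. O' j = trunc_dist d p j (\<omega> j)"
    by metis
  define \<eta> where "\<eta> x = arg_min_on (d x) S" for x
  have \<eta>: "\<eta> x \<in> S" "\<And>i. i \<in> S \<Longrightarrow> d x (\<eta> x) \<le> d x i" for x
    using fin by (simp_all add: \<eta>_def arg_min_if_finite(1) arg_min_least)
  \<comment> \<open>Needed for overlapping sets: if \<open>\<eta>\<close> maps \<open>B\<close> into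
    \<open>A\<close>, then \<open>B \<inter> S \<subseteq> A\<close>.\<close>
  have \<eta>_id: "\<eta> x = x" if "x \<in> S" for x
  proof -
    have "d x (\<eta> x) \<le> 0" using \<eta>(2)[OF that, of x] that assms(3) by auto
    then show ?thesis using \<eta>(1)[of x] that assms(3)
      by (metis UnI1 nonneg order_antisym subsetD zero)
  qed
  have V: "0 \<le> V j" "V j \<le> p" for j
    using \<open>p \<ge> 0\<close> by (auto simp: \<sigma>(2) trunc_dist_def)
  have O: "0 \<le> O' j" for j
    using \<open>p \<ge> 0\<close> by (auto simp: \<omega>(2) trunc_dist_def)
  \<comment> \<open>The triangle inequality through \<open>\<omega> j\<close> survives truncation:
    once a distance on the right reaches \<open>p\<close>, so does the whole right-hand
    side.\<close>
  have reroute: "trunc_dist d p j (\<eta> (\<omega> j)) \<le> 2 * O' j + V j" if "j \<in> C" for j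
  proof -
    have in_F: "\<omega> j \<in> F" "\<sigma> j \<in> F" "\<eta> (\<omega> j) \<in> F" using \<omega> \<sigma> \<eta> assms(3,4) by auto
    have "d j (\<eta> (\<omega> j)) \<le> d j (\<omega> j) + d (\<omega> j) (\<eta> (\<omega> j))"
      using triangle in_F that by auto
    also have "d (\<omega> j) (\<eta> (\<omega> j)) \<le> d (\<omega> j) (\<sigma> j)" using \<eta>(2) \<sigma>(1) by auto
    also have "d (\<omega> j) (\<sigma> j) \<le> d (\<omega> j) j + d j (\<sigma> j)"
      using triangle in_F that by auto
    also have "d (\<omega> j) j = d j (\<omega> j)" by (rule commute)
    finally have "d j (\<eta> (\<omega> j)) \<le> 2 * d j (\<omega> j) + d j (\<sigma> j)" by simp
    moreover have "0 \<le> d j (\<omega> j)" "0 \<le> d j (\<sigma> j)" by simp_all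
    ultimately show ?thesis
      using \<open>p \<ge> 0\<close> unfolding \<omega>(2) \<sigma>(2) trunc_dist_def by linarith
  qed
  define c where "c = 1 + 1 / real l"
  have c: "c \<ge> 1" by (simp add: c_def)
  have c3: "3 + 2 / real l = 1 + 2 * c" by (simp add: c_def)
  \<comment> \<open>Client by client, charge for whichever term attains the minimum in the claim.\<close>
  define a where "a j = (if (1 + 2 * c) * O' j \<le> c * p then O' j - V j else 0)" for j
  define b where "b j = (if (1 + 2 * c) * O' j \<le> c * p then 2 * O' j else p - V j)" for j
  have b: "b j \<ge> 0" for j using O V by (auto simp: b_def)
  \<comment> \<open>The first case is an equality; the second uses
    \<open>c * (p - V j) \<le> c * p - V j\<close>, from \<open>c \<ge> 1\<close> and
    \<open>V j \<ge> 0\<close>.\<close>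
  have ab: "a j + c * b j \<le> min ((1 + 2 * c) * O' j) (c * p) - V j" for j
  proof (cases "(1 + 2 * c) * O' j \<le> c * p")
    case True
    then show ?thesis by (simp add: a_def b_def algebra_simps)
  next
    case False
    have "V j \<le> c * V j" using mult_right_mono[OF c V(1)] by simp
    then show ?thesis using False by (simp add: a_def b_def right_diff_distrib)
  qed
  have client: "trunc_dist_set d p j ((S - A) \<union> B) - V j
      \<le> (if \<omega> j \<in> B then a j else 0) + (if \<sigma> j \<in> A then b j else 0)"
    if "j \<in> C" "A \<subseteq> S" "B \<subseteq> Sstar" "card A = card B" "{x \<in> Sstar. \<eta> x \<in> A} \<subseteq> B" for j A B
  proof -
    let ?T = "(S - A) \<union> B"
    have finAB: "finite A" "finite B" using that fin finite_subset by blast+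
    \<comment> \<open>If \<open>A = S\<close>, equal cardinality makes \<open>B\<close>
      nonempty.\<close>
    then have T: "finite ?T" "?T \<noteq> {}" using that(4) fin by auto
    have le: "trunc_dist_set d p j ?T \<le> trunc_dist d p j i" if "i \<in> ?T" for i
      using trunc_dist_set_le[OF T(1) that] .
    have le_p: "trunc_dist_set d p j ?T \<le> p"
      using T(2) le by (metis ex_in_conv min.bounded_iff trunc_dist_def)
    have keep: "trunc_dist_set d p j ?T \<le> V j" if "\<sigma> j \<notin> A"
      using le[of "\<sigma> j"] that \<sigma> by auto
    have open': "trunc_dist_set d p j ?T \<le> O' j" if "\<omega> j \<in> B"
      using le[of "\<omega> j"] that \<omega> by auto
    have move: "trunc_dist_set d p j ?T \<le> 2 * O' j + V j" if "\<omega> j \<notin> B"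
    proof -
      \<comment> \<open>Were \<open>\<eta> (\<omega> j)\<close> closed, the fibre condition would
        put \<open>\<omega> j\<close> into \<open>B\<close>.\<close>
      have "\<eta> (\<omega> j) \<in> ?T" using that \<open>{x \<in> Sstar. \<eta> x \<in> A} \<subseteq> B\<close> \<omega>(1) \<eta>(1) by auto
      then show ?thesis using le reroute[OF \<open>j \<in> C\<close>] by force
    qed
    show ?thesis
      using le_p keep open' move O[of j] by (auto simp: a_def b_def)
  qed
  \<comment> \<open>Each opened median carries one \<open>\<rho>\<close>, which absorbs the
    efficiency threshold of every swap and adds up to \<open>k * \<rho>\<close>.\<close>
  define \<alpha> where "\<alpha> x = (\<Sum>j\<in>{j \<in> C. \<omega> j = x}. a j) + \<rho>" for x
  define \<beta> where "\<beta> y = (\<Sum>j\<in>{j \<in> C. \<sigma> j = y}. b j)" for y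
  have sum_\<alpha>: "sum \<alpha> B = (\<Sum>j\<in>C. if \<omega> j \<in> B then a j else 0) + real (card B) * \<rho>"
    if "finite B" for B
    unfolding \<alpha>_def using sum_fibres[OF \<open>finite C\<close> that] by (simp add: sum.distrib)
  have sum_\<beta>: "sum \<beta> A = (\<Sum>j\<in>C. if \<sigma> j \<in> A then b j else 0)" if "finite A" for A
    unfolding \<beta>_def using sum_fibres[OF \<open>finite C\<close> that] .
  have "0 \<le> sum \<alpha> Sstar + (1 + 1 / real l) * sum \<beta> S"
  proof (rule swap_averaging)
    show "finite S" "finite Sstar" "card S = card Sstar" "\<eta> ` Sstar \<subseteq> S" "l \<ge> 1"
      using fin assms \<eta> by auto
    show "0 \<le> \<beta> y" for y unfolding \<beta>_def using b by (intro sum_nonneg) auto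
    show "0 \<le> sum \<alpha> B + sum \<beta> A"
      if A: "A \<subseteq> S" "B \<subseteq> Sstar" "card A = card B" "card A \<le> l" "{x \<in> Sstar. \<eta> x \<in> A} \<subseteq> B"
        "\<eta> ` B \<subseteq> A \<or> card A = 1" for A B
    proof -
      have finAB: "finite A" "finite B" using A fin finite_subset by blast+
      have "B \<inter> S \<subseteq> A \<or> card A = 1" using A(6) \<eta>_id by force
      then have "pcost d C p S - real (card A) * \<rho> \<le> pcost d C p ((S - A) \<union> B)"
        using A finAB assms fin by (intro pcost_exchange_ge[where F = F and l = l]) auto
      moreover have "pcost d C p ((S - A) \<union> B) - pcost d C p S
          = (\<Sum>j\<in>C. trunc_dist_set d p j ((S - A) \<union> B) - V j)"
        by (simp add: pcost_def V_def sum_subtractf)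
      moreover have "\<dots> \<le> (\<Sum>j\<in>C. (if \<omega> j \<in> B then a j else 0) + (if \<sigma> j \<in> A then b j else 0))"
        using client A by (intro sum_mono) auto
      ultimately show ?thesis
        using A(3) by (simp add: sum_\<alpha> sum_\<beta> finAB sum.distrib)
    qed
  qed
  \<comment> \<open>Over all of \<open>Sstar\<close> and \<open>S\<close> both membership tests
    succeed for every client.\<close>
  also have "\<dots> = (\<Sum>j\<in>C. a j + c * b j) + real k * \<rho>"
    using \<omega>(1) \<sigma>(1) assms(6) fin
    by (simp add: sum_\<alpha> sum_\<beta> c_def sum.distrib sum_distrib_left)
  also have "(\<Sum>j\<in>C. a j + c * b j) \<le> (\<Sum>j\<in>C. min ((1 + 2 * c) * O' j) (c * p) - V j)"
    by (intro sum_mono ab)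
  finally show ?thesis
    unfolding c3 by (simp add: pcost_def sum_subtractf V_def O'_def c_def)
qed

end
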